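(* Let $B\in\mathbb R^{n\times m}$ and $C\in\mathbb R^{n\times p}$, and consider the cone $$K=\{By+Cw : y\in\mathbb R^m,\ w\in\mathbb R^p,\ y\ge 0\}.$$ Given $g\in\mathbb R^n$, exactly one of the following alternatives holds: either $g\in K$, or else there is a vector $d\in\mathbb R^n$ such that $$g^\top d<0,\qquad B^\top d\ge 0,\qquad C^\top d=0 .$$
   Context: Inequalities between vectors are componentwise; $y\ge 0$ means that all components of $y$ are nonnegative. *)

theory Defs
  imports "Jordan_Normal_Form.Matrix"
begin

text \<open>On \<^typ>\<open>real vec\<close>, the relation \<open>\<le>\<close> of the library is componentwise and includes
  equality of dimensions; \<open>0\<^sub>v k\<close> is the zero vector of length \<open>k\<close>.\<close>

definition gen_cone :: "real mat \<Rightarrow> real mat \<Rightarrow> real vec set" where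
  "gen_cone B C = {B *\<^sub>v y + C *\<^sub>v w | y w.
     y \<in> carrier_vec (dim_col B) \<and> w \<in> carrier_vec (dim_col C) \<and> 0\<^sub>v (dim_col B) \<le> y}"

end

theory Submission
  imports Defs
begin

text \<open>
  The two alternatives exclude each other because
  \<open>g \<bullet> d = y \<bullet> (B\<^sup>T *\<^sub>v d) + w \<bullet> (C\<^sup>T *\<^sub>v d)\<close> whenever \<open>g = B *\<^sub>v y + C *\<^sub>v w\<close>: a direction \<open>d\<close> as in
  the second alternative makes the right-hand side nonnegative and the left-hand side negative.

  That one of them holds is Farkas' lemma (\<open>farkas_finite_family\<close>) for the generators given by
  the columns of \<open>B\<close>, of \<open>C\<close> and of \<open>-C\<close>. Its proof is algebraic, by induction on the number of
  generators, in the manner of Bartl. Suppose that \<open>b \<bullet> d\<close> is nonnegative wherever all generators are, and single out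
  one generator \<open>c\<close>. If the others already force \<open>b \<bullet> d\<close> to be nonnegative, \<open>c\<close> gets weight zero.
  Otherwise some direction \<open>e\<close> violates this, and after scaling \<open>c \<bullet> e = -1\<close>. The map
  \<open>d \<mapsto> d + (c \<bullet> d) e\<close> is a projection onto the hyperplane orthogonal to \<open>c\<close>, on which the
  constraint belonging to \<open>c\<close> is void; the induction hypothesis applies to the other generators
  composed with this projection. Undoing the projection leaves a multiple of \<open>c\<close>, whose weight
  is nonnegative because at \<open>e\<close> the other generators are nonnegative and \<open>b\<close> is negative.
\<close>

text \<open>
  The conclusion identifies \<open>b\<close> with a nonnegative combination of the \<open>a i\<close> through scalar products
  with all \<open>d\<close>; this is the form in which composing with a projection is plain algebra of reals. The vectors \<open>a\<close> and \<open>b\<close> vary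
  in the induction, since both are replaced by their compositions with the projection.
\<close>
lemma farkas_finite_family:
  fixes a :: "'i \<Rightarrow> real vec" and b :: "real vec"
  assumes "finite I"
    and "\<And>i. i \<in> I \<Longrightarrow> a i \<in> carrier_vec n" and "b \<in> carrier_vec n"
    and "\<And>d. d \<in> carrier_vec n \<Longrightarrow> (\<forall>i\<in>I. 0 \<le> a i \<bullet> d) \<Longrightarrow> 0 \<le> b \<bullet> d"
  shows "\<exists>l. (\<forall>i\<in>I. 0 \<le> l i) \<and> (\<forall>d\<in>carrier_vec n. b \<bullet> d = (\<Sum>i\<in>I. l i * (a i \<bullet> d)))"
  using assms
proof (induction I arbitrary: a b rule: finite_induct)
  case empty
  have "b \<bullet> d = 0" if d: "d \<in> carrier_vec n" for d
  proof -
    have "0 \<le> b \<bullet> d" "0 \<le> b \<bullet> (- 1 \<cdot>\<^sub>v d)"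
      using d by (auto intro!: empty(3))
    then show ?thesis using empty(2) d by simp
  qed
  then show ?case by simp
next
  case (insert k I)
  note a_carrier = insert.prems(1) and b_carrier = insert.prems(2) and dual = insert.prems(3)
  show ?case
  proof (cases "\<forall>d\<in>carrier_vec n. (\<forall>i\<in>I. 0 \<le> a i \<bullet> d) \<longrightarrow> 0 \<le> b \<bullet> d")
    case True
    then obtain l where l: "\<forall>i\<in>I. 0 \<le> l i"
        "\<forall>d\<in>carrier_vec n. b \<bullet> d = (\<Sum>i\<in>I. l i * (a i \<bullet> d))"
      using insert.IH[of a b] a_carrier b_carrier by auto
    have "(\<Sum>i\<in>I. (l(k := 0)) i * (a i \<bullet> d)) = (\<Sum>i\<in>I. l i * (a i \<bullet> d))" for d
      using insert.hyps(2) by (intro sum.cong) auto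
    with l insert.hyps show ?thesis by (intro exI[of _ "l(k := 0)"]) auto
  next
    case False
    then obtain e' where e': "e' \<in> carrier_vec n" "\<forall>i\<in>I. 0 \<le> a i \<bullet> e'" "b \<bullet> e' < 0"
      by fastforce
    define c where "c = a k"
    have c: "c \<in> carrier_vec n" using a_carrier c_def by simp
    have neg: "c \<bullet> e' < 0"
    proof (rule ccontr)
      assume "\<not> c \<bullet> e' < 0"
      then show False using dual[of e'] e' by (simp add: c_def)
    qed
    define e where "e = (- 1 / (c \<bullet> e')) \<cdot>\<^sub>v e'"
    have e: "e \<in> carrier_vec n" using e' e_def by simp
    have ce: "c \<bullet> e = - 1" using c e'(1) neg by (simp add: e_def)
    have ae: "0 \<le> a i \<bullet> e" if "i \<in> I" for i
      using that a_carrier[of i] e' neg by (simp add: e_def divide_nonneg_neg divide_nonpos_neg)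
    have be: "b \<bullet> e < 0"
      using b_carrier e' neg by (simp add: e_def divide_neg_neg)
    \<comment> \<open>\<open>T v\<close> represents the functional \<open>v\<close> composed with the projection along \<open>e\<close>.\<close>
    define T where "T v = v + (v \<bullet> e) \<cdot>\<^sub>v c" for v
    have T_carrier: "T v \<in> carrier_vec n" if "v \<in> carrier_vec n" for v
      using that c by (simp add: T_def)
    have T_prod: "T v \<bullet> d = v \<bullet> d + (v \<bullet> e) * (c \<bullet> d)"
      if "v \<in> carrier_vec n" "d \<in> carrier_vec n" for v d
      using that c by (simp add: T_def add_scalar_prod_distrib[of _ n])
    have T_proj: "T v \<bullet> d = v \<bullet> (d + (c \<bullet> d) \<cdot>\<^sub>v e)"
      if "v \<in> carrier_vec n" "d \<in> carrier_vec n" for v d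
      using that e by (simp add: T_prod scalar_prod_add_distrib[of _ n])
    have T_dual: "0 \<le> T b \<bullet> d" if d: "d \<in> carrier_vec n" and pos: "\<forall>i\<in>I. 0 \<le> T (a i) \<bullet> d" for d
    proof -
      let ?d = "d + (c \<bullet> d) \<cdot>\<^sub>v e"
      have "c \<bullet> ?d = 0"
        using c d e ce by (simp add: scalar_prod_add_distrib[of _ n])
      then have "\<forall>i\<in>insert k I. 0 \<le> a i \<bullet> ?d"
        using pos d a_carrier by (auto simp: c_def T_proj)
      then show ?thesis using dual[of ?d] d e b_carrier by (simp add: T_proj)
    qed
    obtain l where l: "\<forall>i\<in>I. 0 \<le> l i"
        "\<forall>d\<in>carrier_vec n. T b \<bullet> d = (\<Sum>i\<in>I. l i * (T (a i) \<bullet> d))"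
      using insert.IH[of "\<lambda>i. T (a i)" "T b"] a_carrier b_carrier T_carrier T_dual by auto
    \<comment> \<open>The weight of \<open>c\<close> collects what the projection added on either side of the identity for \<open>T b\<close>.\<close>
    define m where "m = (\<Sum>i\<in>I. l i * (a i \<bullet> e)) - b \<bullet> e"
    have "0 \<le> (\<Sum>i\<in>I. l i * (a i \<bullet> e))"
      using l(1) ae by (intro sum_nonneg) simp
    then have m: "0 \<le> m" using be by (simp add: m_def)
    have comb: "b \<bullet> d = m * (c \<bullet> d) + (\<Sum>i\<in>I. l i * (a i \<bullet> d))" if d: "d \<in> carrier_vec n" for d
    proof -
      have "b \<bullet> d + (b \<bullet> e) * (c \<bullet> d) = (\<Sum>i\<in>I. l i * (T (a i) \<bullet> d))"
        using l(2) d b_carrier by (simp flip: T_prod)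
      also have "\<dots> = (\<Sum>i\<in>I. l i * (a i \<bullet> d) + l i * (a i \<bullet> e) * (c \<bullet> d))"
        using a_carrier d by (intro sum.cong) (auto simp: T_prod algebra_simps)
      also have "\<dots> = (\<Sum>i\<in>I. l i * (a i \<bullet> d)) + (\<Sum>i\<in>I. l i * (a i \<bullet> e)) * (c \<bullet> d)"
        by (simp add: sum.distrib sum_distrib_right)
      finally show ?thesis by (simp add: m_def algebra_simps)
    qed
    have "(\<Sum>i\<in>I. (l(k := m)) i * (a i \<bullet> d)) = (\<Sum>i\<in>I. l i * (a i \<bullet> d))" for d
      using insert.hyps(2) by (intro sum.cong) auto
    with l(1) m comb insert.hyps show ?thesis
      by (intro exI[of _ "l(k := m)"]) (auto simp: c_def)
  qed
qed

lemma mult_mat_vec_scalar_prod: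
  fixes A :: "real mat"
  assumes A: "A \<in> carrier_mat n m" and y: "y \<in> carrier_vec m" and d: "d \<in> carrier_vec n"
  shows "(A *\<^sub>v y) \<bullet> d = (\<Sum>j<m. y $ j * (col A j \<bullet> d))"
proof -
  have "(A *\<^sub>v y) \<bullet> d = y \<bullet> (A\<^sup>T *\<^sub>v d)"
    using transpose_vec_mult_scalar[of A n m y d] A y d
    by (metis comm_scalar_prod mult_mat_vec_carrier transpose_carrier_mat)
  then show ?thesis
    using A by (simp add: scalar_prod_def[of y] atLeast0LessThan)
qed

lemma transpose_mult_vec_nonneg_iff:
  fixes A :: "real mat"
  assumes "A \<in> carrier_mat n m"
  shows "0\<^sub>v m \<le> A\<^sup>T *\<^sub>v d \<longleftrightarrow> (\<forall>j<m. 0 \<le> col A j \<bullet> d)"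
  using assms by (auto simp: less_eq_vec_def)

lemma transpose_mult_vec_eq_0_iff:
  fixes A :: "real mat"
  assumes "A \<in> carrier_mat n m"
  shows "A\<^sup>T *\<^sub>v d = 0\<^sub>v m \<longleftrightarrow> (\<forall>j<m. col A j \<bullet> d = 0)"
  using assms by (auto simp: vec_eq_iff)

lemma vec_eqI_scalar_prod:
  fixes u v :: "real vec"
  assumes "u \<in> carrier_vec n" "v \<in> carrier_vec n"
    and "\<And>d. d \<in> carrier_vec n \<Longrightarrow> u \<bullet> d = v \<bullet> d"
  shows "u = v"
proof (rule eq_vecI)
  fix i assume "i < dim_vec v"
  then show "u $ i = v $ i"
    using assms(3)[of "unit_vec n i"] assms(1,2) by simp
qed (use assms in simp)

theorem theorem10:
  fixes B C :: "real mat" and g :: "real vec" and n m p :: nat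
  assumes "B \<in> carrier_mat n m" and "C \<in> carrier_mat n p" and "g \<in> carrier_vec n"
  shows "(g \<in> gen_cone B C \<or> (\<exists>d \<in> carrier_vec n. g \<bullet> d < 0 \<and> 0\<^sub>v m \<le> B\<^sup>T *\<^sub>v d \<and> C\<^sup>T *\<^sub>v d = 0\<^sub>v p)) \<and>
    \<not> (g \<in> gen_cone B C \<and> (\<exists>d \<in> carrier_vec n. g \<bullet> d < 0 \<and> 0\<^sub>v m \<le> B\<^sup>T *\<^sub>v d \<and> C\<^sup>T *\<^sub>v d = 0\<^sub>v p))"
proof -
  note B = assms(1) and C = assms(2) and g = assms(3)
  have dir: "0\<^sub>v m \<le> B\<^sup>T *\<^sub>v d \<and> C\<^sup>T *\<^sub>v d = 0\<^sub>v p \<longleftrightarrow>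
      (\<forall>j<m. 0 \<le> col B j \<bullet> d) \<and> (\<forall>j<p. col C j \<bullet> d = 0)" for d
    using B C by (simp add: transpose_mult_vec_nonneg_iff transpose_mult_vec_eq_0_iff)
  have cone_prod: "(B *\<^sub>v y + C *\<^sub>v w) \<bullet> d =
      (\<Sum>j<m. y $ j * (col B j \<bullet> d)) + (\<Sum>j<p. w $ j * (col C j \<bullet> d))"
    if "y \<in> carrier_vec m" "w \<in> carrier_vec p" "d \<in> carrier_vec n" for y w d
    using that B C
    by (simp add: add_scalar_prod_distrib[of _ n] mult_mat_vec_scalar_prod[of _ n])
  have excl: False
    if mem: "g \<in> gen_cone B C" and d: "d \<in> carrier_vec n" "g \<bullet> d < 0"
      "0\<^sub>v m \<le> B\<^sup>T *\<^sub>v d \<and> C\<^sup>T *\<^sub>v d = 0\<^sub>v p" for d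
  proof -
    obtain y w where yw: "g = B *\<^sub>v y + C *\<^sub>v w" "y \<in> carrier_vec m" "w \<in> carrier_vec p" "0\<^sub>v m \<le> y"
      using mem B C by (auto simp: gen_cone_def)
    have "g \<bullet> d = (\<Sum>j<m. y $ j * (col B j \<bullet> d))"
      using d yw by (simp add: cone_prod dir)
    also have "0 \<le> \<dots>"
      using d(3) yw(2,4) by (intro sum_nonneg) (auto simp: dir less_eq_vec_def)
    finally show False using d(2) by simp
  qed
  have "g \<in> gen_cone B C"
    if none: "\<not> (\<exists>d \<in> carrier_vec n. g \<bullet> d < 0 \<and> 0\<^sub>v m \<le> B\<^sup>T *\<^sub>v d \<and> C\<^sup>T *\<^sub>v d = 0\<^sub>v p)"
  proof -
    \<comment> \<open>The free coefficients \<open>w\<close> become differences of nonnegative ones by listing both \<open>C\<close> and \<open>-C\<close>.\<close>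
    define I where "I = {..<m} <+> ({..<p} <+> {..<p})"
    define a where "a = case_sum (col B) (case_sum (col C) (\<lambda>j. (- 1) \<cdot>\<^sub>v col C j))"
    have a_carrier: "a i \<in> carrier_vec n" if "i \<in> I" for i
      using that B C by (auto simp: I_def a_def)
    have colC: "((- 1) \<cdot>\<^sub>v col C j) \<bullet> d = - (col C j \<bullet> d)" if "d \<in> carrier_vec n" for j d
      using that C by simp
    have dual: "0 \<le> g \<bullet> d" if d: "d \<in> carrier_vec n" and pos: "\<forall>i\<in>I. 0 \<le> a i \<bullet> d" for d
    proof -
      have "0 \<le> col B j \<bullet> d" if "j < m" for j
        using pos that by (force simp: I_def a_def)
      moreover have "col C j \<bullet> d = 0" if "j < p" for j
      proof -
        have "Inr (Inl j) \<in> I" "Inr (Inr j) \<in> I" using that by (auto simp: I_def)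
        then have "0 \<le> a (Inr (Inl j)) \<bullet> d" "0 \<le> a (Inr (Inr j)) \<bullet> d" using pos by blast+
        then show ?thesis using d by (simp add: a_def colC)
      qed
      ultimately have "0\<^sub>v m \<le> B\<^sup>T *\<^sub>v d \<and> C\<^sup>T *\<^sub>v d = 0\<^sub>v p" by (simp add: dir)
      then show ?thesis using none d by force
    qed
    obtain l where l: "\<forall>i\<in>I. 0 \<le> l i"
        "\<forall>d\<in>carrier_vec n. g \<bullet> d = (\<Sum>i\<in>I. l i * (a i \<bullet> d))"
      using farkas_finite_family[of I a n g] a_carrier g dual by (auto simp: I_def)
    define y where "y = vec m (\<lambda>j. l (Inl j))"
    define w where "w = vec p (\<lambda>j. l (Inr (Inl j)) - l (Inr (Inr j)))"
    have yw: "y \<in> carrier_vec m" "w \<in> carrier_vec p" by (simp_all add: y_def w_def)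
    have "0\<^sub>v m \<le> y" using l(1) by (auto simp: less_eq_vec_def y_def I_def)
    moreover have "g = B *\<^sub>v y + C *\<^sub>v w"
    proof (rule vec_eqI_scalar_prod[OF g])
      show "B *\<^sub>v y + C *\<^sub>v w \<in> carrier_vec n" using B C yw by simp
      fix d :: "real vec" assume d: "d \<in> carrier_vec n"
      then have "g \<bullet> d = (\<Sum>j<m. l (Inl j) * (col B j \<bullet> d)) +
          ((\<Sum>j<p. l (Inr (Inl j)) * (col C j \<bullet> d)) - (\<Sum>j<p. l (Inr (Inr j)) * (col C j \<bullet> d)))"
        using l(2) by (simp add: I_def a_def sum.Plus colC sum_negf)
      also have "\<dots> = (B *\<^sub>v y + C *\<^sub>v w) \<bullet> d"
        using d yw by (simp add: cone_prod y_def w_def left_diff_distrib flip: sum_subtractf)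
      finally show "g \<bullet> d = (B *\<^sub>v y + C *\<^sub>v w) \<bullet> d" .
    qed
    ultimately show ?thesis using B C yw by (auto simp: gen_cone_def)
  qed
  with excl show ?thesis by blast
qed

end
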